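(* Let $A \in \{0,1\}^{n \times n}$ be a symmetric matrix with support such that $\operatorname{diag}(A) = 0$ and the graph $G(A_M)$ is connected. Define $W = Z = 2\left(\mathrm{Id} - SK(A)\right)$, where $\mathrm{Id}$ is the $n\times n$ identity matrix. Then $W$ and $Z$ are symmetric positive semidefinite $n\times n$ matrices satisfying (a) $Z \succeq W$; (b) $\operatorname{null}(W) = \operatorname{span}(\mathbf{1})$; (c) $\operatorname{diag}(Z) = 2\cdot\mathbf{1}$, i.e. $Z_{ii} = 2$ for all $i$; (d) $\mathbf{1}^T Z \mathbf{1} = 0$; and $W$ and $Z$ adhere to the sparsity structure of $G(A)$, i.e. $Z_{ij} = W_{ij} = 0$ for all $i \neq j$ with $A_{ij} = 0$.
   Context: Notation: $\mathbf{1}$ is the all-ones vector; $Z \succeq W$ means that $Z - W$ is symmetric positive semidefinite; $\operatorname{null}$ denotes the null space (kernel). For a symmetric matrix $B \in \{0,1\}^{n\times n}$, $G(B)$ is the unweighted undirected graph on $\{1,\dots,n\}$ with adjacency matrix $B$. Support: a nonnegative square matrix $A \in \mathbb{R}_+^{n\times n}$ is viewed as the weighted bi-adjacency matrix of a bipartite graph on two sets of $n$ nodes, with an edge between node $i$ of the first set and node $j$ of the second set exactly when $A_{ij} > 0$. $A$ has support if this bipartite graph has a perfect matching (equivalently, there is a permutation $\sigma$ of $\{1,\dots,n\}$ with $A_{i\sigma(i)} > 0$ for all $i$). $A_M \in \mathbb{R}_+^{n\times n}$ denotes the matrix obtained from $A$ by keeping only the entries whose corresponding edge belongs to some perfect matching,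 and setting all other entries to zero. Sinkhorn-Knopp algorithm (doubly stochastic case): starting from a nonnegative square matrix $A$, alternately (i) scale each row so that it sums to one, and (ii) scale each column so that it sums to one, and repeat. $SK(A)$ denotes the limit of the resulting sequence of matrices when it exists. A theorem of Sinkhorn and Knopp states that the algorithm converges if and only if $A$ has support, so $SK(A)$ is well defined for a matrix with support. *)

theory Defs
  imports "HOL-Analysis.Analysis" "Graph_Theory.Digraph_Component"
begin

definition psd :: "real^'n^'n \<Rightarrow> bool" where
  "psd M \<longleftrightarrow> transpose M = M \<and> (\<forall>x. 0 \<le> x \<bullet> (M *v x))"

definition loewner_ge :: "real^'n^'n \<Rightarrow> real^'n^'n \<Rightarrow> bool"  (infix \<open>\<succeq>\<close> 50) where
  "Z \<succeq> W \<longleftrightarrow> psd (Z - W)"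

definition null_space :: "real^'n^'n \<Rightarrow> (real^'n) set" where
  "null_space M = {x. M *v x = 0}"

(* An undirected graph is encoded as a digraph with a pair of opposite arcs for every edge;
   for a symmetric 0/1 matrix B the arc set below is symmetric. *)
definition adj_graph :: "real^'n^'n \<Rightarrow> 'n pair_pre_digraph" where
  "adj_graph B = \<lparr> pverts = UNIV, parcs = {(i, j). B $ i $ j = 1} \<rparr>"

(* The pair (i, j) stands for the edge between node i of the first set (rows)
   and node j of the second set (columns). *)
definition bipartite_edges :: "real^'n^'n \<Rightarrow> ('n \<times> 'n) set" where
  "bipartite_edges A = {(i, j). A $ i $ j > 0}"

definition perfect_matching :: "real^'n^'n \<Rightarrow> ('n \<times> 'n) set \<Rightarrow> bool" where
  "perfect_matching A M \<longleftrightarrow>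
     M \<subseteq> bipartite_edges A \<and> (\<forall>i. \<exists>!j. (i, j) \<in> M) \<and> (\<forall>j. \<exists>!i. (i, j) \<in> M)"

definition has_support :: "real^'n^'n \<Rightarrow> bool" where
  "has_support A \<longleftrightarrow> (\<exists>M. perfect_matching A M)"

definition matching_part :: "real^'n^'n \<Rightarrow> real^'n^'n" where
  "matching_part A =
     (\<chi> i j. if \<exists>M. perfect_matching A M \<and> (i, j) \<in> M then A $ i $ j else 0)"

definition scale_rows :: "real^'n^'n \<Rightarrow> real^'n^'n" where
  "scale_rows A = (\<chi> i j. A $ i $ j / (\<Sum>l\<in>UNIV. A $ i $ l))"

definition scale_cols :: "real^'n^'n \<Rightarrow> real^'n^'n" where
  "scale_cols A = (\<chi> i j. A $ i $ j / (\<Sum>l\<in>UNIV. A $ l $ j))"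

primrec sinkhorn_iter :: "real^'n^'n \<Rightarrow> nat \<Rightarrow> real^'n^'n" where
  "sinkhorn_iter A 0 = A"
| "sinkhorn_iter A (Suc k) =
     (if even k then scale_rows (sinkhorn_iter A k) else scale_cols (sinkhorn_iter A k))"

(* The limit of the whole sequence, row-scaled and column-scaled iterates alike;
   unspecified when the sequence does not converge. *)
definition SK :: "real^'n^'n \<Rightarrow> real^'n^'n" where
  "SK A = lim (sinkhorn_iter A)"

end

(* Row and column scalings change pair_ln X (the sum of X_ij ln M_ij) by an amount that is the same
   for all doubly stochastic X supported on A. From the first iterate on, this quantity increases
   (by ln r <= r - 1, since the row or column sums add up to n) and is bounded above by 0. Hence the
   increments tend to 0, which makes every limit point S of the iteration doubly stochastic, and the
   entries where some X is positive stay bounded away from 0. Moreover pair_ln X S - pair_ln X A is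
   independent of X. Comparing two such S, T yields that the sum of (S_ij - T_ij)(ln S_ij - ln T_ij)
   is 0, so S = T by strict monotonicity of ln. This gives convergence; for symmetric A the transpose
   of S has the same properties, so S is symmetric. Finally 2(Id - S) is the Laplacian of the graph
   weighted by S, all of whose matching edges have positive weight. *)

theory Submission
  imports Defs
begin

section \<open>Doubly stochastic matrices and the logarithmic pairing under scaling\<close>

definition doubly_stochastic_on :: "real^'n^'n \<Rightarrow> (real^'n^'n) set" where
  "doubly_stochastic_on A = {X. (\<forall>i j. 0 \<le> X $ i $ j)
     \<and> (\<forall>i. (\<Sum>j\<in>UNIV. X $ i $ j) = 1) \<and> (\<forall>j. (\<Sum>i\<in>UNIV. X $ i $ j) = 1)
     \<and> (\<forall>i j. A $ i $ j = 0 \<longrightarrow> X $ i $ j = 0)}"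

text \<open>For a permutation matrix \<open>X\<close> supported where \<open>M\<close> is positive,
  this is the logarithm of the product of the entries of \<open>M\<close> along the permutation. As
  \<open>ln 0 = 0\<close>, zero entries of \<open>M\<close> contribute nothing.\<close>

definition pair_ln :: "real^'n^'n \<Rightarrow> real^'n^'n \<Rightarrow> real" where
  "pair_ln X M = (\<Sum>i\<in>UNIV. \<Sum>j\<in>UNIV. X $ i $ j * ln (M $ i $ j))"

lemma doubly_stochastic_onD:
  assumes "X \<in> doubly_stochastic_on A"
  shows "0 \<le> X $ i $ j" "(\<Sum>j\<in>UNIV. X $ i $ j) = 1" "(\<Sum>i\<in>UNIV. X $ i $ j) = 1"
    "A $ i $ j = 0 \<Longrightarrow> X $ i $ j = 0"
  using assms by (auto simp: doubly_stochastic_on_def)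

text \<open>Where \<open>M\<close> vanishes so does \<open>X\<close>; elsewhere \<open>ln\<close>
  splits the quotient. The rows of \<open>X\<close> sum to 1, so the correction no longer mentions
  \<open>X\<close>.\<close>

lemma pair_ln_scale_rows:
  assumes "X \<in> doubly_stochastic_on M" "\<And>i j. 0 \<le> M $ i $ j" "\<And>i. 0 < (\<Sum>l\<in>UNIV. M $ i $ l)"
  shows "pair_ln X (scale_rows M) = pair_ln X M - (\<Sum>i\<in>UNIV. ln (\<Sum>l\<in>UNIV. M $ i $ l))"
proof -
  have "X $ i $ j * ln (scale_rows M $ i $ j)
      = X $ i $ j * ln (M $ i $ j) - X $ i $ j * ln (\<Sum>l\<in>UNIV. M $ i $ l)" for i j
  proof (cases "M $ i $ j = 0")
    case False
    then have "0 < M $ i $ j" using assms(2)[of i j] by simp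
    then show ?thesis
      using assms(3)[of i] by (simp add: scale_rows_def ln_div algebra_simps)
  qed (simp add: doubly_stochastic_onD(4)[OF assms(1)])
  then have "pair_ln X (scale_rows M) = pair_ln X M
      - (\<Sum>i\<in>UNIV. (\<Sum>j\<in>UNIV. X $ i $ j) * ln (\<Sum>l\<in>UNIV. M $ i $ l))"
    by (simp add: pair_ln_def sum_subtractf sum_distrib_right)
  then show ?thesis by (simp add: doubly_stochastic_onD(2)[OF assms(1)])
qed

text \<open>Lets the column case of the pairing be deduced from the row case.\<close>

lemma scale_cols_eq: "scale_cols M = transpose (scale_rows (transpose M))"
  by (simp add: scale_cols_def scale_rows_def transpose_def)

lemma pair_ln_transpose: "pair_ln (transpose X) (transpose M) = pair_ln X M"
  unfolding pair_ln_def by (subst sum.swap) (simp add: transpose_def)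

lemma transpose_in_doubly_stochastic_on:
  "transpose X \<in> doubly_stochastic_on (transpose M) \<longleftrightarrow> X \<in> doubly_stochastic_on M"
  by (auto simp: doubly_stochastic_on_def transpose_def)

lemma pair_ln_scale_cols:
  assumes "X \<in> doubly_stochastic_on M" "\<And>i j. 0 \<le> M $ i $ j" "\<And>j. 0 < (\<Sum>l\<in>UNIV. M $ l $ j)"
  shows "pair_ln X (scale_cols M) = pair_ln X M - (\<Sum>j\<in>UNIV. ln (\<Sum>l\<in>UNIV. M $ l $ j))"
proof -
  have "pair_ln X (scale_cols M) = pair_ln (transpose X) (scale_rows (transpose M))"
    unfolding scale_cols_eq using pair_ln_transpose[of "transpose X" "scale_rows (transpose M)"]
    by (simp add: transpose_transpose)
  also have "\<dots> = pair_ln (transpose X) (transpose M)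
      - (\<Sum>j\<in>UNIV. ln (\<Sum>l\<in>UNIV. transpose M $ j $ l))"
    by (rule pair_ln_scale_rows, simp add: transpose_in_doubly_stochastic_on assms(1))
      (use assms in \<open>auto simp: transpose_def\<close>)
  finally show ?thesis by (simp add: pair_ln_transpose) (simp add: transpose_def)
qed

text \<open>AM-GM in logarithmic form: the terms \<open>r i - 1\<close> bounding the logarithms
  cancel in total.\<close>

lemma sum_ln_le_zero:
  fixes r :: "'n::finite \<Rightarrow> real"
  assumes "\<And>i. 0 < r i" "(\<Sum>i\<in>UNIV. r i) = real CARD('n)"
  shows "(\<Sum>i\<in>UNIV. ln (r i)) \<le> 0"
proof -
  have "(\<Sum>i\<in>UNIV. ln (r i)) \<le> (\<Sum>i\<in>UNIV. r i - 1)"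
    by (intro sum_mono ln_le_minus_one assms)
  then show ?thesis by (simp add: sum_subtractf assms)
qed

text \<open>Equality case of AM-GM: the nonnegative gaps \<open>r i - 1 - ln (r i)\<close> sum to 0,
  so each is 0.\<close>

lemma sum_ln_eq_zero_imp:
  fixes r :: "'n::finite \<Rightarrow> real"
  assumes "\<And>i. 0 < r i" "(\<Sum>i\<in>UNIV. r i) = real CARD('n)" "(\<Sum>i\<in>UNIV. ln (r i)) = 0"
  shows "r i = 1"
proof -
  have "(\<Sum>i\<in>UNIV. r i - 1 - ln (r i)) = 0" by (simp add: sum_subtractf assms)
  moreover have "0 \<le> r i - 1 - ln (r i)" for i using ln_le_minus_one[OF assms(1)[of i]] by simp
  ultimately have "r i - 1 - ln (r i) = 0" by (simp add: sum_nonneg_eq_0_iff)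
  then show ?thesis using ln_eq_minus_one[OF assms(1)[of i]] by simp
qed

text \<open>A zero row or column of \<open>M\<close> would be one of \<open>P\<close> as well. This
  rules out division by zero in the scalings.\<close>

lemma doubly_stochastic_on_sums_pos:
  assumes "P \<in> doubly_stochastic_on M" "\<And>i j. 0 \<le> M $ i $ j"
  shows "0 < (\<Sum>l\<in>UNIV. M $ i $ l)" "0 < (\<Sum>l\<in>UNIV. M $ l $ j)"
proof -
  have "(\<Sum>l\<in>UNIV. M $ i $ l) \<noteq> 0"
  proof
    assume "(\<Sum>l\<in>UNIV. M $ i $ l) = 0"
    then have "M $ i $ l = 0" for l using assms(2) by (simp add: sum_nonneg_eq_0_iff)
    then show False using doubly_stochastic_onD(2,4)[OF assms(1)] by (metis sum.neutral zero_neq_one)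
  qed
  then show "0 < (\<Sum>l\<in>UNIV. M $ i $ l)" using assms(2) by (simp add: sum_nonneg less_le)
  have "(\<Sum>l\<in>UNIV. M $ l $ j) \<noteq> 0"
  proof
    assume "(\<Sum>l\<in>UNIV. M $ l $ j) = 0"
    then have "M $ l $ j = 0" for l using assms(2) by (simp add: sum_nonneg_eq_0_iff)
    then show False using doubly_stochastic_onD(3,4)[OF assms(1)] by (metis sum.neutral zero_neq_one)
  qed
  then show "0 < (\<Sum>l\<in>UNIV. M $ l $ j)" using assms(2) by (simp add: sum_nonneg less_le)
qed

section \<open>The iterates: zero pattern, normalised sums and change of the pairing\<close>

lemma doubly_stochastic_on_cong:
  assumes "\<And>i j. M $ i $ j = 0 \<longleftrightarrow> N $ i $ j = 0"
  shows "doubly_stochastic_on M = doubly_stochastic_on N"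
  using assms by (auto simp: doubly_stochastic_on_def)

text \<open>Support is expressed by the witness \<open>P\<close>; in the theorem it is the
  permutation matrix of a perfect matching.\<close>

locale sinkhorn =
  fixes A P :: "real^'n^'n"
  assumes nonneg: "\<And>i j. 0 \<le> A $ i $ j"
    and P: "P \<in> doubly_stochastic_on A"
begin

abbreviation B where "B \<equiv> sinkhorn_iter A"

text \<open>Proved jointly: the preserved zero pattern keeps \<open>P\<close> admissible for
  \<open>B k\<close>, so the divisors of the next scaling are positive.\<close>

lemma iter_nonneg: "0 \<le> B k $ i $ j"
  and iter_zero_iff: "B k $ i $ j = 0 \<longleftrightarrow> A $ i $ j = 0"
proof (induction k arbitrary: i j)
  case (Suc k)
  have "P \<in> doubly_stochastic_on (B k)"
    using P Suc.IH(2) by (subst doubly_stochastic_on_cong[of _ A]) auto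
  note pos = doubly_stochastic_on_sums_pos[OF this Suc.IH(1)]
  { case 1 show ?case using pos[THEN less_imp_le] Suc.IH(1) by (simp add: scale_rows_def scale_cols_def) }
  { case 2 show ?case using pos[THEN less_imp_neq] Suc.IH(2) by (auto simp: scale_rows_def scale_cols_def) }
qed (simp_all add: nonneg)

lemma doubly_stochastic_on_iter: "doubly_stochastic_on (B k) = doubly_stochastic_on A"
  by (rule doubly_stochastic_on_cong) (rule iter_zero_iff)

lemma rowsum_pos: "0 < (\<Sum>l\<in>UNIV. B k $ i $ l)"
  and colsum_pos: "0 < (\<Sum>l\<in>UNIV. B k $ l $ j)"
  using doubly_stochastic_on_sums_pos[of P "B k"] P iter_nonneg doubly_stochastic_on_iter by auto

lemma rowsum_iter: "odd k \<Longrightarrow> (\<Sum>l\<in>UNIV. B k $ i $ l) = 1"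
  by (cases k) (use rowsum_pos[THEN less_imp_neq] in
    \<open>auto simp: scale_rows_def simp flip: sum_divide_distrib\<close>)

lemma colsum_iter: "even k \<Longrightarrow> 0 < k \<Longrightarrow> (\<Sum>l\<in>UNIV. B k $ l $ j) = 1"
  by (cases k) (use colsum_pos[THEN less_imp_neq] in
    \<open>auto simp: scale_cols_def simp flip: sum_divide_distrib\<close>)

lemma sum_iter:
  assumes "0 < k"
  shows "(\<Sum>i\<in>UNIV. \<Sum>j\<in>UNIV. B k $ i $ j) = real CARD('n)"
    and "(\<Sum>j\<in>UNIV. \<Sum>i\<in>UNIV. B k $ i $ j) = real CARD('n)"
proof -
  have eq: "(\<Sum>j\<in>UNIV. \<Sum>i\<in>UNIV. B k $ i $ j) = (\<Sum>i\<in>UNIV. \<Sum>j\<in>UNIV. B k $ i $ j)"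
    by (rule sum.swap)
  show 1: "(\<Sum>i\<in>UNIV. \<Sum>j\<in>UNIV. B k $ i $ j) = real CARD('n)"
    by (cases "even k") (use assms eq in \<open>simp_all add: rowsum_iter colsum_iter\<close>)
  show "(\<Sum>j\<in>UNIV. \<Sum>i\<in>UNIV. B k $ i $ j) = real CARD('n)" using 1 eq by simp
qed

lemma iter_le_1: "0 < k \<Longrightarrow> B k $ i $ j \<le> 1"
  using member_le_sum[of j UNIV "\<lambda>l. B k $ i $ l"] member_le_sum[of i UNIV "\<lambda>l. B k $ l $ j"]
    rowsum_iter[of k i] colsum_iter[of k j] iter_nonneg
  by (cases "even k") auto

text \<open>For \<open>k > 0\<close> the sums normalised by the step producing \<open>B k\<close>
  are all 1, so one of the two terms vanishes and a single formula serves row and column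
  steps.\<close>

definition gain :: "nat \<Rightarrow> real" where
  "gain k = - (\<Sum>i\<in>UNIV. ln (\<Sum>l\<in>UNIV. B k $ i $ l)) - (\<Sum>j\<in>UNIV. ln (\<Sum>l\<in>UNIV. B k $ l $ j))"

text \<open>Unlike \<open>pair_ln_gain\<close> this includes \<open>k = 0\<close>, where neither the
  row nor the column sums need be 1.\<close>

lemma pair_ln_Suc_diff:
  assumes "X \<in> doubly_stochastic_on A" "Y \<in> doubly_stochastic_on A"
  shows "pair_ln X (B (Suc k)) - pair_ln X (B k) = pair_ln Y (B (Suc k)) - pair_ln Y (B k)"
  using assms by (simp add: pair_ln_scale_rows pair_ln_scale_cols doubly_stochastic_on_iter
      iter_nonneg rowsum_pos colsum_pos)

lemma pair_ln_gain:
  assumes "X \<in> doubly_stochastic_on A" "0 < k"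
  shows "pair_ln X (B (Suc k)) = pair_ln X (B k) + gain k"
  using assms by (simp add: pair_ln_scale_rows pair_ln_scale_cols doubly_stochastic_on_iter
      iter_nonneg rowsum_pos colsum_pos gain_def colsum_iter rowsum_iter)

text \<open>The invariant of the iteration, obtained by telescoping; it survives in the limit as the
  last clause of \<open>sinkhorn_limit\<close>.\<close>

lemma pair_ln_diff:
  assumes "X \<in> doubly_stochastic_on A" "Y \<in> doubly_stochastic_on A"
  shows "pair_ln X (B k) - pair_ln X A = pair_ln Y (B k) - pair_ln Y A"
proof (induction k)
  case (Suc k)
  then show ?case using pair_ln_Suc_diff[OF assms, of k] by linarith
qed simp

lemma gain_nonneg: "0 < k \<Longrightarrow> 0 \<le> gain k"
  unfolding gain_def
  using sum_ln_le_zero[OF rowsum_pos sum_iter(1), of k] sum_ln_le_zero[OF colsum_pos sum_iter(2), of k] by simp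

lemma pair_ln_term_nonpos:
  assumes "X \<in> doubly_stochastic_on A" "0 < k"
  shows "X $ i $ j * ln (B k $ i $ j) \<le> 0"
  by (cases "B k $ i $ j = 0") (use assms iter_nonneg[of k i j] iter_le_1[of k i j]
    in \<open>auto simp: mult_nonneg_nonpos doubly_stochastic_onD(1)\<close>)

lemma pair_ln_nonpos:
  assumes "X \<in> doubly_stochastic_on A" "0 < k"
  shows "pair_ln X (B k) \<le> 0"
  unfolding pair_ln_def by (intro sum_nonpos pair_ln_term_nonpos assms)

text \<open>All terms are nonpositive, so dropping the others can only increase the sum.\<close>

lemma pair_ln_le_term:
  assumes "X \<in> doubly_stochastic_on A" "0 < k"
  shows "pair_ln X (B k) \<le> X $ i $ j * ln (B k $ i $ j)"
proof -
  have "- (X $ i $ j * ln (B k $ i $ j)) \<le> (\<Sum>j\<in>UNIV. - (X $ i $ j * ln (B k $ i $ j)))"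
    by (rule member_le_sum) (use pair_ln_term_nonpos[OF assms] in auto)
  also have "\<dots> \<le> (\<Sum>i\<in>UNIV. \<Sum>j\<in>UNIV. - (X $ i $ j * ln (B k $ i $ j)))"
    by (rule member_le_sum[of i UNIV "\<lambda>i. \<Sum>j\<in>UNIV. - (X $ i $ j * ln (B k $ i $ j))"])
      (use pair_ln_term_nonpos[OF assms] in \<open>auto intro!: sum_nonneg\<close>)
  finally show ?thesis by (simp add: pair_ln_def sum_negf)
qed

section \<open>Monotonicity, lower bounds and limit points\<close>

lemma pair_ln_incseq:
  assumes "X \<in> doubly_stochastic_on A"
  shows "incseq (\<lambda>k. pair_ln X (B (Suc k)))"
  by (rule incseq_SucI) (metis pair_ln_gain[OF assms] gain_nonneg zero_less_Suc le_add_same_cancel1)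

lemma gain_tendsto_0: "gain \<longlonglongrightarrow> 0"
proof -
  obtain L where L: "(\<lambda>k. pair_ln P (B (Suc k))) \<longlonglongrightarrow> L"
    using incseq_convergent[OF pair_ln_incseq[OF P], of 0] pair_ln_nonpos[OF P] by (metis zero_less_Suc)
  have "(\<lambda>k. pair_ln P (B (Suc (Suc k))) - pair_ln P (B (Suc k))) \<longlonglongrightarrow> L - L"
    by (intro tendsto_diff L LIMSEQ_Suc[OF L])
  then have "(\<lambda>k. gain (Suc k)) \<longlonglongrightarrow> 0"
    by (simp add: pair_ln_gain[OF P] del: sinkhorn_iter.simps)
  then show ?thesis by (rule LIMSEQ_imp_Suc)
qed

text \<open>From index 1 on the pairing never falls below its value at \<open>B 1\<close>, hence
  neither does any single term; solving for the entry gives a bound independent of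
  \<open>k\<close>.\<close>

lemma iter_lower_bound:
  assumes X: "X \<in> doubly_stochastic_on A" and pos: "0 < X $ i $ j" and "0 < k"
  shows "exp (pair_ln X (B 1) / X $ i $ j) \<le> B k $ i $ j"
proof -
  obtain m where k: "k = Suc m" using \<open>0 < k\<close> by (cases k) auto
  have "pair_ln X (B 1) \<le> pair_ln X (B k)"
    using incseqD[OF pair_ln_incseq[OF X], of 0 m] k by simp
  also have "\<dots> \<le> X $ i $ j * ln (B k $ i $ j)" by (rule pair_ln_le_term) fact+
  finally have "pair_ln X (B 1) / X $ i $ j \<le> ln (B k $ i $ j)"
    using pos by (simp add: field_simps)
  moreover have "0 < B k $ i $ j"
    using iter_nonneg[of k i j] iter_zero_iff[of k i j] doubly_stochastic_onD(4)[OF X, of i j] pos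
    by (metis less_le)
  ultimately show ?thesis by (metis exp_le_cancel_iff exp_ln)
qed

text \<open>Describes the limit without the iteration: \<open>S\<close> has the largest possible
  support, and the last clause is the first-order condition for minimising the relative entropy of
  \<open>S\<close> with respect to \<open>A\<close>.\<close>

definition sinkhorn_limit :: "real^'n^'n \<Rightarrow> bool" where
  "sinkhorn_limit S \<longleftrightarrow> S \<in> doubly_stochastic_on A
     \<and> (\<forall>X\<in>doubly_stochastic_on A. \<forall>i j. 0 < X $ i $ j \<longrightarrow> 0 < S $ i $ j)
     \<and> (\<forall>X\<in>doubly_stochastic_on A. \<forall>Y\<in>doubly_stochastic_on A.
          pair_ln X S - pair_ln X A = pair_ln Y S - pair_ln Y A)"

lemma sinkhorn_limit_subseq:
  assumes r: "strict_mono r" and S: "(B \<circ> r) \<longlonglongrightarrow> S"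
  shows "sinkhorn_limit S"
proof -
  \<comment> \<open>The bounds on the iterates start at index 1, so \<open>B 0 = A\<close> has to be
    skipped.\<close>
  have r_pos: "\<forall>\<^sub>F k in sequentially. 0 < r k"
    by (rule eventually_subseq[OF r eventually_gt_at_top])
  have S_ij: "(\<lambda>k. B (r k) $ i $ j) \<longlonglongrightarrow> S $ i $ j" for i j
    using S by (intro tendsto_vec_nth) (simp add: o_def)
  have S_nonneg: "0 \<le> S $ i $ j" for i j
    by (rule tendsto_lowerbound[OF S_ij]) (simp_all add: iter_nonneg)
  have S_zero: "S $ i $ j = 0" if "A $ i $ j = 0" for i j
    using S_ij[of i j] that by (simp add: iter_zero_iff[THEN iffD2] LIMSEQ_const_iff)
  have S_pos: "0 < S $ i $ j" if X: "X \<in> doubly_stochastic_on A" and "0 < X $ i $ j" for X i j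
  proof -
    have "exp (pair_ln X (B 1) / X $ i $ j) \<le> S $ i $ j"
      by (rule tendsto_lowerbound[OF S_ij])
        (rule eventually_mono[OF r_pos], erule iter_lower_bound[OF that], simp)
    then show ?thesis by (meson exp_gt_zero less_le_trans)
  qed
  \<comment> \<open>The limit may have more zeros than \<open>A\<close>, but none where
    \<open>P\<close> is positive. Thus its row and column sums are positive and \<open>ln\<close> is
    continuous there.\<close>
  have "P $ i $ j = 0" if "S $ i $ j = 0" for i j
    using S_pos[OF P, of i j] doubly_stochastic_onD(1)[OF P, of i j] that by (cases "0 < P $ i $ j") simp_all
  then have "P \<in> doubly_stochastic_on S" using P by (simp add: doubly_stochastic_on_def)
  note row = doubly_stochastic_on_sums_pos(1)[OF this S_nonneg]
    and col = doubly_stochastic_on_sums_pos(2)[OF this S_nonneg]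
  have "(\<lambda>k. \<Sum>i\<in>UNIV. \<Sum>j\<in>UNIV. B (r k) $ i $ j) \<longlonglongrightarrow> (\<Sum>i\<in>UNIV. \<Sum>j\<in>UNIV. S $ i $ j)"
    by (intro tendsto_sum S_ij)
  moreover have "(\<lambda>k. \<Sum>i\<in>UNIV. \<Sum>j\<in>UNIV. B (r k) $ i $ j) \<longlonglongrightarrow> real CARD('n)"
    by (rule tendsto_eventually) (use r_pos in \<open>auto elim!: eventually_mono simp: sum_iter\<close>)
  ultimately have tot: "(\<Sum>i\<in>UNIV. \<Sum>j\<in>UNIV. S $ i $ j) = real CARD('n)"
    by (rule LIMSEQ_unique)
  then have tot': "(\<Sum>j\<in>UNIV. \<Sum>i\<in>UNIV. S $ i $ j) = real CARD('n)"
    by (subst sum.swap)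
  have "(gain \<circ> r) \<longlonglongrightarrow>
      - (\<Sum>i\<in>UNIV. ln (\<Sum>l\<in>UNIV. S $ i $ l)) - (\<Sum>j\<in>UNIV. ln (\<Sum>l\<in>UNIV. S $ l $ j))"
    unfolding gain_def o_def
    by (intro tendsto_intros S_ij) (use row col in \<open>auto simp: less_le\<close>)
  moreover have "(gain \<circ> r) \<longlonglongrightarrow> 0"
    by (rule LIMSEQ_subseq_LIMSEQ[OF gain_tendsto_0 r])
  ultimately have "- (\<Sum>i\<in>UNIV. ln (\<Sum>l\<in>UNIV. S $ i $ l))
      - (\<Sum>j\<in>UNIV. ln (\<Sum>l\<in>UNIV. S $ l $ j)) = 0"
    by (rule LIMSEQ_unique)
  \<comment> \<open>Both sums are at most 0 and they add up to 0.\<close>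
  then have "(\<Sum>i\<in>UNIV. ln (\<Sum>l\<in>UNIV. S $ i $ l)) = 0" "(\<Sum>j\<in>UNIV. ln (\<Sum>l\<in>UNIV. S $ l $ j)) = 0"
    using sum_ln_le_zero[OF row tot] sum_ln_le_zero[OF col tot'] by linarith+
  then have "(\<Sum>l\<in>UNIV. S $ i $ l) = 1" "(\<Sum>l\<in>UNIV. S $ l $ j) = 1" for i j
    using sum_ln_eq_zero_imp[OF row tot] sum_ln_eq_zero_imp[OF col tot'] by auto
  then have S_ds: "S \<in> doubly_stochastic_on A"
    using S_nonneg S_zero by (simp add: doubly_stochastic_on_def)
  have pair_S: "(\<lambda>k. pair_ln X (B (r k))) \<longlonglongrightarrow> pair_ln X S" if X: "X \<in> doubly_stochastic_on A" for X
    unfolding pair_ln_def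
  proof (intro tendsto_sum)
    fix i j
    show "(\<lambda>k. X $ i $ j * ln (B (r k) $ i $ j)) \<longlonglongrightarrow> X $ i $ j * ln (S $ i $ j)"
    \<comment> \<open>If \<open>X\<close> vanishes here the term is constantly 0, even though the
      logarithm may diverge; otherwise the limit entry is positive.\<close>
    proof (cases "X $ i $ j = 0")
      case False
      then have "0 < S $ i $ j" using S_pos[OF X] doubly_stochastic_onD(1)[OF X] by (simp add: less_le)
      then show ?thesis by (intro tendsto_intros S_ij) simp
    qed simp
  qed
  have "pair_ln X S - pair_ln X A = pair_ln Y S - pair_ln Y A"
    if X: "X \<in> doubly_stochastic_on A" and Y: "Y \<in> doubly_stochastic_on A" for X Y
  proof (rule LIMSEQ_unique)
    show "(\<lambda>k. pair_ln X (B (r k)) - pair_ln X A) \<longlonglongrightarrow> pair_ln X S - pair_ln X A"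
      by (intro tendsto_intros pair_S X)
    show "(\<lambda>k. pair_ln X (B (r k)) - pair_ln X A) \<longlonglongrightarrow> pair_ln Y S - pair_ln Y A"
      unfolding pair_ln_diff[OF X Y] by (intro tendsto_intros pair_S Y)
  qed
  then show ?thesis using S_ds S_pos unfolding sinkhorn_limit_def by blast
qed

lemma sinkhorn_limit_unique:
  assumes S: "sinkhorn_limit S" and T: "sinkhorn_limit T"
  shows "S = T"
proof -
  have ds: "S \<in> doubly_stochastic_on A" "T \<in> doubly_stochastic_on A"
    using S T by (auto simp: sinkhorn_limit_def)
  let ?t = "\<lambda>i j. (S $ i $ j - T $ i $ j) * (ln (S $ i $ j) - ln (T $ i $ j))"
  \<comment> \<open>Each of \<open>S\<close> and \<open>T\<close> is an admissible \<open>X\<close>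
    for the other, so their supports coincide.\<close>
  have pos: "0 < S $ i $ j \<longleftrightarrow> 0 < T $ i $ j" for i j
    using S T by (auto simp: sinkhorn_limit_def)
  have cases: "(S $ i $ j = 0 \<and> T $ i $ j = 0) \<or> (0 < S $ i $ j \<and> 0 < T $ i $ j)" for i j
    using pos[of i j] doubly_stochastic_onD(1)[OF ds(1), of i j] doubly_stochastic_onD(1)[OF ds(2), of i j]
    by linarith
  have t_nonneg: "0 \<le> ?t i j" for i j
    using cases[of i j] by (cases "S $ i $ j \<le> T $ i $ j")
      (auto simp: zero_le_mult_iff)
  \<comment> \<open>Both limits satisfy the invariance for the pair \<open>S\<close>,
    \<open>T\<close>, with the same contribution of \<open>A\<close>.\<close>
  have "pair_ln S S - pair_ln T S = pair_ln S T - pair_ln T T"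
    using S T ds unfolding sinkhorn_limit_def by (smt (verit))
  then have "(\<Sum>i\<in>UNIV. \<Sum>j\<in>UNIV. ?t i j) = 0"
    by (simp add: pair_ln_def algebra_simps sum.distrib sum_subtractf)
  then have "?t i j = 0" for i j
    using t_nonneg by (simp add: sum_nonneg_eq_0_iff sum_nonneg)
  then have "S $ i $ j = T $ i $ j" for i j
    using cases[of i j] by (metis mult_eq_0_iff ln_inj_iff right_minus_eq)
  then show ?thesis by (simp add: vec_eq_iff)
qed

section \<open>Compactness, convergence and symmetry of the limit\<close>

lemma bounded_iter: "bounded (range B)"
proof -
  \<comment> \<open>The summand \<open>norm A\<close> covers index 0, where entries may exceed
    1.\<close>
  have "norm (B k) \<le> real CARD('n) * real CARD('n) + norm A" for k
  proof (cases "k = 0")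
    case False
    have "norm (B k) \<le> (\<Sum>i\<in>UNIV. norm (B k $ i))"
      by (simp add: norm_vec_def L2_set_le_sum)
    also have "\<dots> \<le> (\<Sum>i\<in>(UNIV::'n set). real CARD('n))"
    proof (rule sum_mono)
      fix i
      have "norm (B k $ i) \<le> (\<Sum>j\<in>UNIV. \<bar>B k $ i $ j\<bar>)" by (rule norm_le_l1_cart)
      also have "\<dots> \<le> (\<Sum>j\<in>(UNIV::'n set). 1)"
        using False by (intro sum_mono) (simp add: iter_nonneg iter_le_1)
      finally show "norm (B k $ i) \<le> real CARD('n)" by simp
    qed
    finally show ?thesis using norm_ge_zero[of A] by (simp add: add_increasing2)
  qed simp
  then show ?thesis by (auto simp: bounded_iff)
qed

lemma iter_subseq_limit:
  fixes r :: "nat \<Rightarrow> nat"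
  assumes "strict_mono r"
  obtains S s where "strict_mono s" "(B \<circ> (r \<circ> s)) \<longlonglongrightarrow> S" "sinkhorn_limit S"
proof -
  have "bounded (range (B \<circ> r))" by (rule bounded_subset[OF bounded_iter]) auto
  then obtain S s where s: "strict_mono s" "((B \<circ> r) \<circ> s) \<longlonglongrightarrow> S"
    using bounded_imp_convergent_subsequence by blast
  then show thesis
    using that sinkhorn_limit_subseq[OF strict_mono_o[OF assms s(1)]] by (simp add: comp_assoc)
qed

text \<open>A subsequence staying away from one limit point would itself have a limit point,
  contradicting uniqueness.\<close>

lemma sinkhorn_limit_SK: "sinkhorn_limit (SK A)"
proof -
  obtain S where S: "sinkhorn_limit S" using iter_subseq_limit[OF strict_mono_id] by blast
  have "B \<longlonglongrightarrow> S"
  proof (rule ccontr)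
    assume "\<not> B \<longlonglongrightarrow> S"
    then obtain e where e: "0 < e" "\<exists>\<^sub>F k in sequentially. e \<le> dist (B k) S"
      by (auto simp: tendsto_iff not_eventually not_less)
    then have "infinite {k. e \<le> dist (B k) S}"
      by (simp flip: cofinite_eq_sequentially add: frequently_cofinite)
    then obtain r :: "nat \<Rightarrow> nat" where r: "strict_mono r" "\<And>n. e \<le> dist (B (r n)) S"
      using infinite_enumerate by (metis mem_Collect_eq)
    obtain T s where T: "strict_mono s" "(B \<circ> (r \<circ> s)) \<longlonglongrightarrow> T" "sinkhorn_limit T"
      using iter_subseq_limit[OF r(1)] by blast
    have "(\<lambda>n. dist (B (r (s n))) S) \<longlonglongrightarrow> dist T S"
      using T(2) by (intro tendsto_intros) (simp add: o_def)
    then have "e \<le> dist T S" by (rule tendsto_lowerbound) (simp_all add: r(2))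
    then show False using sinkhorn_limit_unique[OF S T(3)] e(1) by simp
  qed
  then have "SK A = S" unfolding SK_def by (rule limI)
  then show ?thesis using S by simp
qed

text \<open>Rows are scaled first, so the iterates need not be symmetric; symmetry comes from the
  characterisation of the limit, which is invariant under transposition.\<close>

lemma transpose_SK:
  assumes "transpose A = A"
  shows "transpose (SK A) = SK A"
proof (rule sinkhorn_limit_unique[OF _ sinkhorn_limit_SK])
  have mem: "transpose X \<in> doubly_stochastic_on A" if "X \<in> doubly_stochastic_on A" for X
    using that transpose_in_doubly_stochastic_on[of X A] unfolding assms by blast
  have pair: "pair_ln X (transpose S) = pair_ln (transpose X) S" for X S :: "real^'n^'n"
    using pair_ln_transpose[of "transpose X" S] by simp
  have pair_A: "pair_ln X A = pair_ln (transpose X) A" for X using pair[of X A] assms by simp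
  have indep: "pair_ln X (transpose (SK A)) - pair_ln X A = pair_ln Y (transpose (SK A)) - pair_ln Y A"
    if "X \<in> doubly_stochastic_on A" "Y \<in> doubly_stochastic_on A" for X Y
    using sinkhorn_limit_SK mem[OF that(1)] mem[OF that(2)]
    unfolding sinkhorn_limit_def pair pair_A[of X] pair_A[of Y] by blast
  have "0 < transpose (SK A) $ i $ j" if "X \<in> doubly_stochastic_on A" "0 < X $ i $ j" for X i j
  proof -
    have "0 < transpose X $ j $ i" using that(2) by (simp add: transpose_def)
    then have "0 < SK A $ j $ i"
      using sinkhorn_limit_SK mem[OF that(1)] unfolding sinkhorn_limit_def by blast
    then show ?thesis by (simp add: transpose_def)
  qed
  then show "sinkhorn_limit (transpose (SK A))"
    using indep mem sinkhorn_limit_SK unfolding sinkhorn_limit_def by blast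
qed

end

section \<open>Permutation matrices of matchings, connectivity and the Laplacian form\<close>

lemma perfect_matching_doubly_stochastic_on:
  assumes "perfect_matching A M"
  shows "(\<chi> i j. if (i, j) \<in> M then 1 else 0) \<in> doubly_stochastic_on A"
proof -
  have row: "(\<Sum>j\<in>UNIV. if (i, j) \<in> M then 1 else 0) = (1::real)" for i
  proof -
    obtain j where "\<And>j'. (i, j') \<in> M \<longleftrightarrow> j' = j"
      using assms unfolding perfect_matching_def by metis
    then show ?thesis by simp
  qed
  have col: "(\<Sum>i\<in>UNIV. if (i, j) \<in> M then 1 else 0) = (1::real)" for j
  proof -
    obtain i where "\<And>i'. (i', j) \<in> M \<longleftrightarrow> i' = i"
      using assms unfolding perfect_matching_def by metis
    then show ?thesis by simp
  qed
  have "(i, j) \<notin> M" if "A $ i $ j = 0" for i j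
    using assms that by (auto simp: perfect_matching_def bipartite_edges_def)
  then show ?thesis using row col by (auto simp: doubly_stochastic_on_def)
qed

lemma adj_graph_connected_const:
  assumes conn: "Digraph_Component.connected (with_proj (adj_graph B))"
    and edge: "\<And>i j. B $ i $ j = 1 \<Longrightarrow> f i = f j"
  shows "f u = f v"
proof -
  let ?G = "mk_symmetric (with_proj (adj_graph B))"
  have "u \<rightarrow>\<^sup>*\<^bsub>with_proj ?G\<^esub> v"
    using conn by (simp add: Digraph_Component.connected_def strongly_connected_def adj_graph_def)
  then have "(u, v) \<in> (parcs ?G)\<^sup>*" using reachable_rtranclI by fastforce
  then show ?thesis
  proof induction
    case (step y z)
    \<comment> \<open>Connectivity refers to the symmetric closure, so the arc may stem from either
      orientation.\<close>
    from step.hyps(2) have "B $ y $ z = 1 \<or> B $ z $ y = 1"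
      by (auto simp: parcs_mk_symmetric adj_graph_def)
    then show ?case using step.IH edge by metis
  qed simp
qed

text \<open>Expanding the square, the unit row sums turn the first square term into
  \<open>x \<bullet> x\<close> and the unit column sums the second.\<close>

lemma laplacian_quadratic_form:
  fixes S :: "real^'n^'n"
  assumes "S \<in> doubly_stochastic_on A"
  shows "x \<bullet> ((2 *\<^sub>R (mat 1 - S)) *v x) = (\<Sum>i\<in>UNIV. \<Sum>j\<in>UNIV. S $ i $ j * (x $ i - x $ j)\<^sup>2)"
proof -
  have a: "(\<Sum>i\<in>UNIV. \<Sum>j\<in>UNIV. S $ i $ j * (x $ i)\<^sup>2) = x \<bullet> x"
    by (simp add: doubly_stochastic_onD(2)[OF assms] inner_vec_def power2_eq_square
        flip: sum_distrib_right)
  have "(\<Sum>i\<in>UNIV. \<Sum>j\<in>UNIV. S $ i $ j * (x $ j)\<^sup>2) = (\<Sum>j\<in>UNIV. \<Sum>i\<in>UNIV. S $ i $ j * (x $ j)\<^sup>2)"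
    by (rule sum.swap)
  also have "\<dots> = x \<bullet> x"
    by (simp add: doubly_stochastic_onD(3)[OF assms] inner_vec_def power2_eq_square
        flip: sum_distrib_right)
  finally have b: "(\<Sum>i\<in>UNIV. \<Sum>j\<in>UNIV. S $ i $ j * (x $ j)\<^sup>2) = x \<bullet> x" .
  have c: "(\<Sum>i\<in>UNIV. \<Sum>j\<in>UNIV. S $ i $ j * (x $ i * x $ j)) = x \<bullet> (S *v x)"
    by (simp add: inner_vec_def matrix_vector_mult_def sum_distrib_left algebra_simps)
  have "(\<Sum>i\<in>UNIV. \<Sum>j\<in>UNIV. S $ i $ j * (x $ i - x $ j)\<^sup>2)
      = (\<Sum>i\<in>UNIV. \<Sum>j\<in>UNIV. S $ i $ j * (x $ i)\<^sup>2 + S $ i $ j * (x $ j)\<^sup>2 - 2 * (S $ i $ j * (x $ i * x $ j)))"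
    by (simp add: power2_diff algebra_simps)
  also have "\<dots> = 2 * (x \<bullet> x) - 2 * (x \<bullet> (S *v x))"
    using a b c by (simp add: sum.distrib sum_subtractf flip: sum_distrib_left)
  also have "\<dots> = x \<bullet> ((2 *\<^sub>R (mat 1 - S)) *v x)"
    by (simp add: matrix_vector_mult_diff_rdistrib inner_diff_right
        flip: scaleR_matrix_vector_assoc)
  finally show ?thesis ..
qed

theorem theorem1:
  fixes A W Z :: "real^'n^'n"
  assumes "\<forall>i j. A $ i $ j \<in> {0, 1}"
    and "transpose A = A"
    and "has_support A"
    and "\<forall>i. A $ i $ i = 0"
    and "Digraph_Component.connected (with_proj (adj_graph (matching_part A)))"
    and "W = 2 *\<^sub>R (mat 1 - SK A)"
    and "Z = 2 *\<^sub>R (mat 1 - SK A)"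
  shows "psd W \<and> psd Z
    \<and> Z \<succeq> W
    \<and> null_space W = span {1}
    \<and> (\<forall>i. Z $ i $ i = 2)
    \<and> 1 \<bullet> (Z *v 1) = 0
    \<and> (\<forall>i j. i \<noteq> j \<and> A $ i $ j = 0 \<longrightarrow> Z $ i $ j = 0 \<and> W $ i $ j = 0)"
proof -
  let ?S = "SK A"
  obtain M where M: "perfect_matching A M" using assms(3) by (auto simp: has_support_def)
  interpret sinkhorn A "\<chi> i j. if (i, j) \<in> M then 1 else 0"
  proof
    show "0 \<le> A $ i $ j" for i j using assms(1)[rule_format, of i j] by auto
  qed (rule perfect_matching_doubly_stochastic_on[OF M])
  have S: "?S \<in> doubly_stochastic_on A" using sinkhorn_limit_SK by (simp add: sinkhorn_limit_def)
  have sym: "transpose ?S = ?S" by (rule transpose_SK) fact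
  \<comment> \<open>Such an edge lies in a perfect matching, whose permutation matrix is positive
    there; the maximal support of \<open>SK A\<close> transfers this.\<close>
  have S_pos: "0 < ?S $ i $ j" if "matching_part A $ i $ j = 1" for i j
  proof -
    from that obtain N where N: "perfect_matching A N" "(i, j) \<in> N"
      by (auto simp: matching_part_def split: if_splits)
    then have "0 < ((\<chi> i j. if (i, j) \<in> N then 1 else 0) :: real^'n^'n) $ i $ j" by simp
    then show ?thesis
      using sinkhorn_limit_SK perfect_matching_doubly_stochastic_on[OF N(1)]
      unfolding sinkhorn_limit_def by blast
  qed
  have WZ: "W = 2 *\<^sub>R (mat 1 - ?S)" "Z = W" using assms(6,7) by simp_all
  have quad: "x \<bullet> (W *v x) = (\<Sum>i\<in>UNIV. \<Sum>j\<in>UNIV. ?S $ i $ j * (x $ i - x $ j)\<^sup>2)" for x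
    unfolding WZ(1) by (rule laplacian_quadratic_form[OF S])
  have "transpose W = W"
    using sym by (simp add: WZ(1) transpose_def vec_eq_iff mat_def)
  moreover have "0 \<le> x \<bullet> (W *v x)" for x
    unfolding quad by (intro sum_nonneg mult_nonneg_nonneg doubly_stochastic_onD(1)[OF S]) simp
  ultimately have psd: "psd W" by (simp add: psd_def)
  have ge: "Z \<succeq> W" by (simp add: WZ(2) loewner_ge_def psd_def transpose_def vec_eq_iff)
  have W1: "W *v 1 = 0"
    by (simp add: WZ(1) matrix_vector_mult_diff_rdistrib flip: scaleR_matrix_vector_assoc)
      (simp add: matrix_vector_mult_def vec_eq_iff doubly_stochastic_onD(2)[OF S])
  have "null_space W = span {1}"
  proof
    show "span {1} \<subseteq> null_space W"
      using W1 by (auto simp: span_singleton null_space_def matrix_vector_mult_scaleR)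
    show "null_space W \<subseteq> span {1}"
    proof
      fix x assume "x \<in> null_space W"
      then have "(\<Sum>i\<in>UNIV. \<Sum>j\<in>UNIV. ?S $ i $ j * (x $ i - x $ j)\<^sup>2) = 0"
        using quad[of x] by (simp add: null_space_def)
      then have "?S $ i $ j * (x $ i - x $ j)\<^sup>2 = 0" for i j
        using doubly_stochastic_onD(1)[OF S] by (simp add: sum_nonneg_eq_0_iff sum_nonneg)
      \<comment> \<open>The weight of a matching edge is positive, so the squared difference must
        vanish.\<close>
      then have "x $ i = x $ j" if "matching_part A $ i $ j = 1" for i j
        using S_pos[OF that] by (metis mult_eq_0_iff less_irrefl power_eq_0_iff right_minus_eq)
      then have const: "x $ i = x $ j" for i j
        by (rule adj_graph_connected_const[OF assms(5), of "\<lambda>i. x $ i"])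
      \<comment> \<open>Any index would serve, as all coordinates agree.\<close>
      then have "x = (x $ undefined) *\<^sub>R 1" by (simp add: vec_eq_iff)
      then show "x \<in> span {1}" by (metis span_base span_scale singletonI)
    qed
  qed
  \<comment> \<open>The zero diagonal of \<open>A\<close> is inherited by \<open>SK A\<close>,
    leaving twice the identity.\<close>
  moreover have "Z $ i $ i = 2" for i
    using doubly_stochastic_onD(4)[OF S, of i i] assms(4) by (simp add: WZ mat_def)
  moreover have "Z $ i $ j = 0" if "i \<noteq> j" "A $ i $ j = 0" for i j
    using doubly_stochastic_onD(4)[OF S, of i j] that by (simp add: WZ mat_def)
  ultimately show ?thesis using psd ge W1 WZ(2) by simp
qed

end
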